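(* Let $P$ be a rooted forest, and let $P^*$ carry generalized subword order. Then for all $u\le w$ in $P^*$, $$\mu(u,w)=\sum_{\eta_u}(-1)^{d(\eta_u)},$$ where $\mu$ is the Möbius function of $P^*$ and the sum is over all normal embeddings $\eta_u$ of $u$ into $w$.
   Context: For a poset $(P,\le_P)$, $P^*$ is the set of finite words over $P$, with generalized subword order: $u\le w$ iff $w$ has a subword $w(i_1)\cdots w(i_l)$ ($i_1<\dots<i_l$, $l=|u|$) with $u(j)\le_P w(i_j)$ for all $j$. $P$ is a rooted forest if each connected component of its Hasse diagram is a tree with a minimum element. Let $\hat P$ be $P$ with a new minimum $\hat0$ adjoined (so $\hat P$ is a rooted tree); for $x\in P$, $x^-$ is the element adjacent to $x$ on the unique path from $x$ to $\hat 0$ in the Hasse diagram of $\hat P$. For a word $\eta$ over $\hat P$, $\operatorname{Supp}\eta=\{i:\eta(i)\ne\hat0\}$. An expansion of $u$ is a word over $\hat P$ whose restriction to its support equals $u$; an embedding of $u$ into $w$ is an expansion $\eta_u$ of length $|w|$ with $\eta_u(i)\le_{\hat P}w(i)$ for all $i$. A run of $x$'s in $w$ is a maximal index interval $[r,t]$ with $w(r)=\dots=w(t)=x$. An embedding $\eta_u$ is normal if (1) $\eta_u(i)\in\{w(i),w(i)^-,\hat0\}$ for all $i$, and (2) for every $x\in P$ and every run $[r,t]$ of $x$'s in $w$: if $x$ is minimal in $P$ then $\{r+1,\dots,t\}\subseteq\operatorname{Supp}\eta_u$; otherwise $r\in\operatorname{Supp}\eta_u$. The defect is $d(\eta_u)=\#\{i:\eta_u(i)=w(i)^-\}$.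 *)

theory Defs
  imports Main "HOL-Library.Option_ord"
begin

text \<open>
  A poset \<open>P\<close> is a type of class \<open>order\<close>. Its extension by a new minimum is
  \<open>'a option\<close> with the order of Option_ord, where \<open>None\<close> is the added minimum.
  Words are lists; positions are counted from 0.
\<close>

section \<open>Moebius function\<close>

locale locally_finite_poset =
  fixes le :: "'a \<Rightarrow> 'a \<Rightarrow> bool"
  assumes reflp: "reflp le"
    and antisymp: "antisymp le"
    and transp: "transp le"
    and finite_interval: "finite {z. le x z \<and> le z y}"
begin

function mobius :: "'a \<Rightarrow> 'a \<Rightarrow> int" where
  "mobius x y =
    (if x = y then 1
     else if le x y then - (\<Sum>z | le x z \<and> le z y \<and> z \<noteq> y. mobius x z)
     else 0)"
  by pat_completeness auto
termination
proof (relation "measure (\<lambda>(x, y). card {z. le x z \<and> le z y})", goal_cases)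
  case 1
  then show ?case by simp
next
  case (2 x y z)
  then have z: "le x z" "le z y" "z \<noteq> y" and xy: "le x y" by auto
  have "{t. le x t \<and> le t z} \<subset> {t. le x t \<and> le t y}"
    using z xy transpD[OF transp] antisympD[OF antisymp] reflpD[OF reflp] by blast
  then show ?case using psubset_card_mono[OF finite_interval] by simp
qed

declare mobius.simps [simp del]

end

section \<open>Hasse diagrams and rooted forests\<close>

definition covered_by :: "'a::order \<Rightarrow> 'a \<Rightarrow> bool" where
  "covered_by x y \<longleftrightarrow> x < y \<and> \<not> (\<exists>z. x < z \<and> z < y)"

definition hasse_adj :: "'a::order \<Rightarrow> 'a \<Rightarrow> bool" where
  "hasse_adj x y \<longleftrightarrow> covered_by x y \<or> covered_by y x"

definition hasse_component :: "'a::order \<Rightarrow> 'a set" where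
  "hasse_component x = {y. hasse_adj\<^sup>*\<^sup>* x y}"

definition hasse_path :: "'a::order \<Rightarrow> 'a \<Rightarrow> 'a list \<Rightarrow> bool" where
  "hasse_path x y p \<longleftrightarrow>
    p \<noteq> [] \<and> hd p = x \<and> last p = y \<and> distinct p \<and> successively hasse_adj p"

definition hasse_cycle :: "'a::order list \<Rightarrow> bool" where
  "hasse_cycle c \<longleftrightarrow>
    3 \<le> length c \<and> distinct c \<and> successively hasse_adj c \<and> hasse_adj (last c) (hd c)"

text \<open>
  A component is connected by construction, so it is a tree iff it contains no cycle.
  Local finiteness is not part of this notion: without it the Hasse diagram need not
  determine the order.
\<close>

definition rooted_forest :: "'a::order itself \<Rightarrow> bool" where
  "rooted_forest _ \<longleftrightarrow>
    (\<forall>x::'a. \<not> (\<exists>c. hasse_cycle c \<and> set c \<subseteq> hasse_component x) \<and>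
      (\<exists>m \<in> hasse_component x. \<forall>y \<in> hasse_component x. m \<le> y))"

text \<open>
  The element \<open>x\<^sup>-\<close>: the second vertex of the unique path from \<open>x\<close> to the added minimum.
\<close>

definition parent :: "'a::order \<Rightarrow> 'a option" where
  "parent x = (THE y. \<exists>p. hasse_path (Some x) None (Some x # y # p))"

section \<open>Generalized subword order\<close>

definition gen_subword :: "'a::order list \<Rightarrow> 'a list \<Rightarrow> bool" where
  "gen_subword u w \<longleftrightarrow>
    (\<exists>i::nat \<Rightarrow> nat. strict_mono_on {..<length u} i \<and>
      (\<forall>j<length u. i j < length w \<and> u ! j \<le> w ! i j))"

section \<open>Normal embeddings\<close>

definition Supp :: "'a option list \<Rightarrow> nat set" where
  "Supp \<eta> = {i. i < length \<eta> \<and> \<eta> ! i \<noteq> None}"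

definition expansion :: "'a list \<Rightarrow> 'a option list \<Rightarrow> bool" where
  "expansion u \<eta> \<longleftrightarrow> nths \<eta> (Supp \<eta>) = map Some u"

definition embedding :: "'a::order list \<Rightarrow> 'a list \<Rightarrow> 'a option list \<Rightarrow> bool" where
  "embedding u w \<eta> \<longleftrightarrow>
    expansion u \<eta> \<and> length \<eta> = length w \<and> (\<forall>i<length w. \<eta> ! i \<le> Some (w ! i))"

definition const_interval :: "'a list \<Rightarrow> 'a \<Rightarrow> nat \<Rightarrow> nat \<Rightarrow> bool" where
  "const_interval w x r t \<longleftrightarrow> r \<le> t \<and> t < length w \<and> (\<forall>i\<in>{r..t}. w ! i = x)"

definition run :: "'a list \<Rightarrow> 'a \<Rightarrow> nat \<Rightarrow> nat \<Rightarrow> bool" where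
  "run w x r t \<longleftrightarrow> const_interval w x r t \<and>
    (\<forall>r' t'. const_interval w x r' t' \<and> {r..t} \<subseteq> {r'..t'} \<longrightarrow> r' = r \<and> t' = t)"

definition normal_embedding :: "'a::order list \<Rightarrow> 'a list \<Rightarrow> 'a option list \<Rightarrow> bool" where
  "normal_embedding u w \<eta> \<longleftrightarrow> embedding u w \<eta> \<and>
    (\<forall>i<length w. \<eta> ! i \<in> {Some (w ! i), parent (w ! i), None}) \<and>
    (\<forall>x r t. run w x r t \<longrightarrow>
      (if \<not> (\<exists>y. y < x) then {r + 1..t} \<subseteq> Supp \<eta> else r \<in> Supp \<eta>))"

text \<open>
  Since \<open>x\<^sup>-\<close> is the added minimum when \<open>x\<close> is minimal, a position outside the support
  counts towards the defect if it carries a minimal letter of \<open>w\<close>.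
\<close>

definition defect :: "'a::order list \<Rightarrow> 'a option list \<Rightarrow> nat" where
  "defect w \<eta> = card {i. i < length w \<and> \<eta> ! i = parent (w ! i)}"

section \<open>Well-definedness\<close>

text \<open>
  Words over a locally finite rooted forest form a locally finite poset, so their Moebius
  function is defined; the sum over normal embeddings is finite.
\<close>

lemma le_imp_hasse_connected:
  fixes x y :: "'a::order"
  assumes lf: "locally_finite_poset ((\<le>) :: 'a \<Rightarrow> 'a \<Rightarrow> bool)" and "y \<le> x"
  shows "hasse_adj\<^sup>*\<^sup>* x y"
  using \<open>y \<le> x\<close>
proof (induction "card {z. y \<le> z \<and> z \<le> x}" arbitrary: x rule: less_induct)
  case less
  show ?case
  proof (cases "y = x")
    case False
    let ?S = "{z. y \<le> z \<and> z < x}"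
    have fin: "finite {z. y \<le> z \<and> z \<le> x}" for x
      using lf by (rule locally_finite_poset.finite_interval)
    have S: "finite ?S" by (rule finite_subset[OF _ fin[of x]]) auto
    moreover have "y \<in> ?S" using less.prems False by auto
    ultimately obtain z where z: "z \<in> ?S" and max: "\<And>t. t \<in> ?S \<Longrightarrow> z \<le> t \<Longrightarrow> z = t"
      using finite_has_maximal[of ?S] by blast
    have adj: "hasse_adj x z"
      unfolding hasse_adj_def covered_by_def using z max by (auto simp: less_le)
    have "{t. y \<le> t \<and> t \<le> z} \<subset> {t. y \<le> t \<and> t \<le> x}"
    proof (rule psubsetI)
      show "{t. y \<le> t \<and> t \<le> z} \<subseteq> {t. y \<le> t \<and> t \<le> x}" using z by auto
      have "x \<in> {t. y \<le> t \<and> t \<le> x}" "x \<notin> {t. y \<le> t \<and> t \<le> z}"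
        using z less.prems by auto
      then show "{t. y \<le> t \<and> t \<le> z} \<noteq> {t. y \<le> t \<and> t \<le> x}" by blast
    qed
    then have "hasse_adj\<^sup>*\<^sup>* z y"
      using less.hyps[of z] psubset_card_mono[OF fin] z by blast
    with adj show ?thesis by (rule converse_rtranclp_into_rtranclp)
  qed simp
qed

lemma finite_down_set:
  fixes x :: "'a::order"
  assumes lf: "locally_finite_poset ((\<le>) :: 'a \<Rightarrow> 'a \<Rightarrow> bool)" and "rooted_forest TYPE('a)"
  shows "finite {..x}"
proof -
  obtain m where "\<forall>y \<in> hasse_component x. m \<le> y"
    using assms(2) unfolding rooted_forest_def by blast
  then have "{..x} \<subseteq> {z. m \<le> z \<and> z \<le> x}"
    using le_imp_hasse_connected[OF lf] by (auto simp: hasse_component_def)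
  then show ?thesis
    using locally_finite_poset.finite_interval[OF lf] by (rule finite_subset)
qed

lemma gen_subword_length:
  assumes "gen_subword u w"
  shows "length u \<le> length w"
proof -
  obtain i where "strict_mono_on {..<length u} i" "\<forall>j<length u. i j < length w"
    using assms unfolding gen_subword_def by blast
  then have "card {..<length u} \<le> card {..<length w}"
    by (intro card_inj_on_le[of i]) (auto intro: strict_mono_on_imp_inj_on)
  then show ?thesis by simp
qed

lemma gen_subword_trans:
  assumes "gen_subword u v" "gen_subword v w"
  shows "gen_subword u w"
proof -
  obtain i where i: "strict_mono_on {..<length u} i"
      "\<forall>j<length u. i j < length v \<and> u ! j \<le> v ! i j"
    using assms(1) unfolding gen_subword_def by blast
  obtain k where k: "strict_mono_on {..<length v} k"
      "\<forall>j<length v. k j < length w \<and> v ! j \<le> w ! k j"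
    using assms(2) unfolding gen_subword_def by blast
  have "strict_mono_on {..<length u} (k \<circ> i)"
    using i k by (auto simp: strict_mono_on_def)
  moreover have "\<forall>j<length u. (k \<circ> i) j < length w \<and> u ! j \<le> w ! (k \<circ> i) j"
    using i k by (auto intro: order_trans)
  ultimately show ?thesis unfolding gen_subword_def by blast
qed

lemma gen_subword_same_length:
  assumes "gen_subword u w" and len: "length u = length w" and "j < length u"
  shows "u ! j \<le> w ! j"
proof -
  obtain i where i: "strict_mono_on {..<length u} i"
      "\<And>j. j < length u \<Longrightarrow> i j < length w \<and> u ! j \<le> w ! i j"
    using assms(1) unfolding gen_subword_def by blast
  have lower: "j \<le> i j" if "j < length u" for j
    using that
  proof (induction j)
    case (Suc j)
    then have "i j < i (Suc j)" using i(1) by (auto simp: strict_mono_on_def)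
    with Suc show ?case by simp
  qed simp
  have upper: "i j + (length u - j) \<le> length u" if "j < length u" for j
    using that
  proof (induction "length u - j" arbitrary: j)
    case (Suc n)
    show ?case
    proof (cases "Suc j < length u")
      case True
      then have "i j < i (Suc j)" using i(1) by (auto simp: strict_mono_on_def)
      moreover have "i (Suc j) + (length u - Suc j) \<le> length u"
        using Suc.hyps(1)[of "Suc j"] Suc.hyps(2) True by simp
      ultimately show ?thesis using True by linarith
    next
      case False
      then show ?thesis using i(2)[OF Suc.prems] Suc.prems len by linarith
    qed
  qed simp
  have "i j = j" using lower upper[of j] \<open>j < length u\<close> by (simp add: le_antisym)
  then show ?thesis using i(2) \<open>j < length u\<close> by metis
qed

lemma locally_finite_gen_subword:
  assumes "locally_finite_poset ((\<le>) :: 'a::order \<Rightarrow> 'a \<Rightarrow> bool)" and "rooted_forest TYPE('a)"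
  shows "locally_finite_poset (gen_subword :: 'a list \<Rightarrow> 'a list \<Rightarrow> bool)"
proof
  show "reflp (gen_subword :: 'a list \<Rightarrow> 'a list \<Rightarrow> bool)"
    unfolding gen_subword_def
    by (intro reflpI exI[of _ id]) (auto simp: strict_mono_on_def)
  show "transp (gen_subword :: 'a list \<Rightarrow> 'a list \<Rightarrow> bool)"
    using gen_subword_trans by (auto intro: transpI)
  show "antisymp (gen_subword :: 'a list \<Rightarrow> 'a list \<Rightarrow> bool)"
  proof (rule antisympI)
    fix u w :: "'a list"
    assume uw: "gen_subword u w" "gen_subword w u"
    then have len: "length u = length w" by (simp add: gen_subword_length le_antisym)
    show "u = w"
      using gen_subword_same_length[OF uw(1)] gen_subword_same_length[OF uw(2)] len
      by (intro nth_equalityI) (auto intro: order_antisym)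
  qed
  fix u w :: "'a list"
  let ?D = "\<Union>x\<in>set w. {..x}"
  have "{v. gen_subword u v \<and> gen_subword v w} \<subseteq> {v. set v \<subseteq> ?D \<and> length v \<le> length w}"
  proof clarify
    fix v assume v: "gen_subword v w"
    have "y \<in> ?D" if y: "y \<in> set v" for y
    proof -
      obtain j where "j < length v" "y = v ! j" using y by (auto simp: in_set_conv_nth)
      then obtain k where "k < length w" "y \<le> w ! k" using v unfolding gen_subword_def by blast
      then show ?thesis using nth_mem[of k w] by blast
    qed
    then show "set v \<subseteq> ?D \<and> length v \<le> length w" using gen_subword_length[OF v] by blast
  qed
  moreover have "finite ?D" using finite_down_set[OF assms] by blast
  ultimately show "finite {v. gen_subword u v \<and> gen_subword v w}"
    by (rule finite_subset[OF _ finite_lists_length_le])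
qed

lemma finite_normal_embeddings: "finite {\<eta>. normal_embedding u w \<eta>}"
proof (rule finite_subset)
  let ?S = "Some ` set w \<union> parent ` set w \<union> {None}"
  show "{\<eta>. normal_embedding u w \<eta>} \<subseteq> {\<eta>. set \<eta> \<subseteq> ?S \<and> length \<eta> = length w}"
  proof clarify
    fix \<eta> assume "normal_embedding u w \<eta>"
    then have len: "length \<eta> = length w"
      and el: "\<And>i. i < length w \<Longrightarrow> \<eta> ! i \<in> {Some (w ! i), parent (w ! i), None}"
      unfolding normal_embedding_def embedding_def by blast+
    have "y \<in> ?S" if y: "y \<in> set \<eta>" for y
    proof -
      obtain i where i: "i < length w" "y = \<eta> ! i"
        using y by (metis in_set_conv_nth len)
      then have "w ! i \<in> set w" by simp
      with el[OF i(1)] i(2) show ?thesis by auto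
    qed
    then show "set \<eta> \<subseteq> ?S \<and> length \<eta> = length w" using len by blast
  qed
  show "finite {\<eta>. set \<eta> \<subseteq> ?S \<and> length \<eta> = length w}"
    by (rule finite_lists_length_eq) simp
qed

end

theory Submission
  imports Defs "HOL-Library.Sublist"
begin

text \<open>
  A normal embedding into \<open>w\<close> is chosen letter by letter, so the signed formal sum of all
  normal embeddings factors into a product over the positions of \<open>w\<close>: a letter \<open>x\<close> contributes
  \<open>x - x\<^sup>-\<close>, plus the added minimum if \<open>x\<close> repeats the letter before it. When \<open>x\<^sup>-\<close> is the
  added minimum, the last two terms cancel, which accounts for the special treatment of minimal
  letters. Summing over the words above \<open>u\<close> by greedy matching, a letter \<open>x\<close> only matters through
  the question whether it is equal to the next letter of \<open>u\<close>, because \<open>a < x\<close> iff \<open>a \<le> x\<^sup>-\<close>.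
  An induction on \<open>w\<close> shows that the sum is 1 if \<open>u = w\<close> and 0 otherwise, so the signed sums over
  normal embeddings form the inverse of the zeta function.
\<close>

section \<open>Parents in a rooted forest\<close>

lemma ex_lower_cover_above:
  fixes x y :: "'a::order"
  assumes "finite {..x}" "y < x"
  obtains z where "covered_by z x" "y \<le> z"
proof -
  have "finite {z. y \<le> z \<and> z < x}"
    by (rule finite_subset[OF _ assms(1)]) auto
  moreover have "y \<in> {z. y \<le> z \<and> z < x}" using assms by auto
  ultimately obtain z where "z \<in> {z. y \<le> z \<and> z < x}"
      "\<And>t. t \<in> {z. y \<le> z \<and> z < x} \<Longrightarrow> z \<le> t \<Longrightarrow> z = t"
    using finite_has_maximal[of "{z. y \<le> z \<and> z < x}"] by blast
  then have "covered_by z x" "y \<le> z"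
    unfolding covered_by_def by (auto simp: less_le)
  then show ?thesis by (rule that)
qed

text \<open>Choosing lower covers above \<open>y\<close> again and again must end in
  \<open>y\<close>, since down-sets are finite. The list runs downwards, so for target
  \<open>None\<close> it is a path to the added minimum.\<close>

lemma ex_saturated_chain:
  fixes x y :: "'a::order"
  assumes "\<And>z::'a. finite {..z}" "y \<le> x"
  obtains p where "successively (\<lambda>a b. covered_by b a) (x # p)" "last (x # p) = y"
    "set (x # p) \<subseteq> {y..x}" "distinct (x # p)"
proof -
  have "\<exists>p. successively (\<lambda>a b. covered_by b a) (x # p) \<and> last (x # p) = y \<and>
    set (x # p) \<subseteq> {y..x} \<and> distinct (x # p)"
    using assms(2)
  proof (induction "card {..x}" arbitrary: x rule: less_induct)
    case less
    show ?case
    proof (cases "y = x")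
      case True
      then show ?thesis by (intro exI[of _ "[]"]) auto
    next
      case False
      then obtain z where z: "covered_by z x" "y \<le> z"
        using ex_lower_cover_above[OF assms(1), of y x] less.prems by force
      then have "z < x" by (simp add: covered_by_def)
      then have "{..z} \<subset> {..x}" by auto
      then have "card {..z} < card {..x}" using assms(1) by (intro psubset_card_mono)
      then obtain p where "successively (\<lambda>a b. covered_by b a) (z # p)" "last (z # p) = y"
          "set (z # p) \<subseteq> {y..z}" "distinct (z # p)"
        using less.hyps z by blast
      then show ?thesis using z \<open>z < x\<close> less.prems
        by (intro exI[of _ "z # p"]) (auto 0 3)
    qed
  qed
  then show ?thesis using that by blast
qed

lemma set_subset_hasse_component:
  assumes "successively hasse_adj (x # p)"
  shows "set (x # p) \<subseteq> hasse_component x"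
proof -
  have "hasse_adj\<^sup>*\<^sup>* x y" if "y \<in> set (x # p)" for y
    using assms that
  proof (induction p arbitrary: x)
    case (Cons z p)
    then show ?case by (auto intro: converse_rtranclp_into_rtranclp)
  qed simp
  then show ?thesis by (auto simp: hasse_component_def)
qed

text \<open>Both covers lie above the minimum of their component, so they have common lower bounds.
  Saturated chains from them to a maximal common lower bound meet only there, and together with
  \<open>x\<close> they form a cycle.\<close>

lemma unique_lower_cover:
  fixes x y z :: "'a::order"
  assumes lf: "locally_finite_poset ((\<le>) :: 'a \<Rightarrow> 'a \<Rightarrow> bool)" and rf: "rooted_forest TYPE('a)"
    and "covered_by y x" "covered_by z x"
  shows "y = z"
proof (rule ccontr)
  assume neq: "y \<noteq> z"
  note fin = finite_down_set[OF lf rf]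
  have yx: "y < x" "z < x" and incomp: "\<not> y \<le> z" "\<not> z \<le> y"
    using assms(3,4) neq by (auto simp: covered_by_def less_le)
  obtain m where m: "\<And>t. t \<in> hasse_component x \<Longrightarrow> m \<le> t"
    using rf unfolding rooted_forest_def by blast
  have "m \<le> y" "m \<le> z"
    using m le_imp_hasse_connected[OF lf] yx by (auto simp: hasse_component_def)
  then have "m \<in> {..y} \<inter> {..z}" by simp
  then obtain q where q: "q \<in> {..y} \<inter> {..z}"
      and max: "\<And>t. t \<in> {..y} \<inter> {..z} \<Longrightarrow> q \<le> t \<Longrightarrow> q = t"
    using finite_has_maximal[of "{..y} \<inter> {..z}"] fin by blast
  obtain p where p: "successively (\<lambda>a b. covered_by b a) (y # p)" "last (y # p) = q"
    "set (y # p) \<subseteq> {q..y}" "distinct (y # p)"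
    using ex_saturated_chain[OF fin, of q y] q by auto
  obtain r where r: "successively (\<lambda>a b. covered_by b a) (z # r)" "last (z # r) = q"
    "set (z # r) \<subseteq> {q..z}" "distinct (z # r)"
    using ex_saturated_chain[OF fin, of q z] q by auto
  \<comment> \<open>Neither chain is trivial: \<open>q = y\<close> or \<open>q = z\<close> would
    make the two covers comparable.\<close>
  have "r \<noteq> []" "p \<noteq> []" using p(2) r(2) q incomp by auto
  \<comment> \<open>Dropping \<open>q\<close> from the second chain lets the cycle visit it only
    once.\<close>
  define s where "s = butlast (z # r)"
  have s: "z # r = s @ [q]"
    unfolding s_def using r(2) by (metis append_butlast_last_id list.distinct(1))
  then have "s \<noteq> []" "hd s = z" using \<open>r \<noteq> []\<close> by (cases s; auto)+
  txt \<open>The cycle descends from \<open>x\<close> through \<open>y\<close> to \<open>q\<close> and ascends back through \<open>z\<close>.\<close>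
  define c where "c = x # (y # p) @ rev s"
  have adj: "successively hasse_adj c"
  proof -
    have "successively hasse_adj (y # p)"
      using p(1) by (rule successively_mono) (auto simp: hasse_adj_def)
    moreover have "successively hasse_adj (rev (s @ [q]))"
      unfolding successively_rev s[symmetric]
      using r(1) by (rule successively_mono) (auto simp: hasse_adj_def)
    moreover have "last (y # p) = q" by (rule p(2))
    ultimately have "successively hasse_adj ((y # p) @ rev s)"
      unfolding successively_append_iff by (auto simp: successively_Cons hd_rev)
    then show ?thesis
      unfolding c_def using assms(3) by (auto simp: hasse_adj_def)
  qed
  have "distinct c"
  proof -
    have "set (y # p) \<inter> set s = {}"
    proof (rule equals0I)
      fix t assume t: "t \<in> set (y # p) \<inter> set s"
      then have "t \<in> set (z # r)" unfolding s by simp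
      then have "q \<le> t" "t \<le> y" "t \<le> z" using t p(3) r(3) by auto
      then have "q = t" using max by simp
      then show False using t r(4) unfolding s by auto
    qed
    moreover have "set s \<subseteq> {q..z}" using r(3) unfolding s by auto
    then have "x \<notin> set s" using yx by force
    moreover have "x \<notin> set (y # p)" using p(3) yx by force
    moreover have "distinct s" using r(4) unfolding s by simp
    ultimately show ?thesis unfolding c_def using p(4) by auto
  qed
  moreover have "length c \<ge> 3" unfolding c_def using \<open>p \<noteq> []\<close> by (cases p) auto
  moreover have "hasse_adj (last c) (hd c)"
    unfolding c_def using assms(4) \<open>s \<noteq> []\<close> \<open>hd s = z\<close> by (auto simp: last_rev hasse_adj_def)
  ultimately have "hasse_cycle c" using adj by (simp add: hasse_cycle_def)
  moreover have "set c \<subseteq> hasse_component x"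
    using set_subset_hasse_component adj unfolding c_def by (metis append_Cons)
  ultimately show False using rf unfolding rooted_forest_def by blast
qed

section \<open>Covers and parents after adjoining the minimum\<close>

lemma covered_by_Some_iff [simp]: "covered_by (Some x) (Some y) \<longleftrightarrow> covered_by x y"
  unfolding covered_by_def by (metis less_option_Some less_option_None not_None_eq)

text \<open>The only new pair of covers is \<open>None\<close> and \<open>Some t\<close>; it cannot
  occur, because \<open>Some t\<close> would lie strictly between \<open>None\<close> and the
  covered element.\<close>

lemma unique_lower_cover_option:
  fixes x y z :: "'a::order option"
  assumes lf: "locally_finite_poset ((\<le>) :: 'a \<Rightarrow> 'a \<Rightarrow> bool)" and rf: "rooted_forest TYPE('a)"
    and "covered_by y x" "covered_by z x"
  shows "y = z"
proof -
  obtain x' where x: "x = Some x'" using assms(3) by (cases x) (auto simp: covered_by_def)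
  have *: False if "covered_by None (Some x')" "covered_by (Some t) (Some x')" for t
    using that unfolding covered_by_def by (metis less_option_None_Some)
  show ?thesis
    using assms(3,4) unfolding x
    by (cases y; cases z) (auto dest: * unique_lower_cover[OF lf rf])
qed

lemma finite_atMost_option:
  fixes x :: "'a::order option"
  assumes "\<And>z::'a. finite {..z}"
  shows "finite {..x}"
proof (cases x)
  case None
  then have "{..x} \<subseteq> {None}" by (auto dest: less_eq_option_None_is_None)
  then show ?thesis by (rule finite_subset) simp
next
  case (Some a)
  have "{..x} \<subseteq> insert None (Some ` {..a})"
  proof
    fix y assume "y \<in> {..x}"
    then show "y \<in> insert None (Some ` {..a})" using Some by (cases y) auto
  qed
  then show ?thesis using assms by (rule finite_subset[OF _ finite.insertI[OF finite_imageI]])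
qed

text \<open>With unique lower covers, a path that goes up once can never turn down again.\<close>

lemma ascending_path:
  fixes x y :: "'a::order"
  assumes unique: "\<And>a b c::'a. covered_by a c \<Longrightarrow> covered_by b c \<Longrightarrow> a = b"
    and "distinct (x # y # p)" "successively hasse_adj (x # y # p)" "covered_by x y"
  shows "x < last (x # y # p)"
  using assms(2-4)
proof (induction p arbitrary: x y)
  case Nil
  then show ?case by (simp add: covered_by_def)
next
  case (Cons z p)
  have "covered_by y z"
  proof (rule ccontr)
    assume "\<not> covered_by y z"
    then have "covered_by z y" using Cons.prems(2) by (simp add: hasse_adj_def)
    then have "z = x" using Cons.prems(3) unique by blast
    then show False using Cons.prems(1) by simp
  qed
  then have "y < last (y # z # p)" using Cons.prems by (intro Cons.IH) auto
  then show ?case using Cons.prems(3) by (auto simp: covered_by_def)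
qed

text \<open>A saturated chain down to \<open>None\<close> is a path whose second vertex is a lower
  cover. A path that starts upwards keeps rising and cannot end in \<open>None\<close>. As lower
  covers are unique, the \<open>THE\<close> in \<open>parent\<close> is well defined.\<close>

lemma covered_by_parent:
  fixes x :: "'a::order"
  assumes lf: "locally_finite_poset ((\<le>) :: 'a \<Rightarrow> 'a \<Rightarrow> bool)" and rf: "rooted_forest TYPE('a)"
  shows "covered_by (parent x) (Some x)"
proof -
  note fin = finite_atMost_option[OF finite_down_set[OF lf rf]]
  note unique = unique_lower_cover_option[OF lf rf]
  obtain p where p: "successively (\<lambda>a b. covered_by b a) (Some x # p)" "last (Some x # p) = None"
      "distinct (Some x # p)"
    using ex_saturated_chain[OF fin less_eq_option_None] by blast
  then obtain y q where pq: "p = y # q" by (cases p) auto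
  have y: "covered_by y (Some x)" using p(1) pq by simp
  have "successively hasse_adj (Some x # p)"
    using p(1) by (rule successively_mono) (auto simp: hasse_adj_def)
  then have ex: "\<exists>p. hasse_path (Some x) None (Some x # y # p)"
    using p(2,3) unfolding hasse_path_def pq by (intro exI[of _ q]) simp
  have "t = y" if path: "\<exists>p. hasse_path (Some x) None (Some x # t # p)" for t
  proof -
    obtain p where "hasse_path (Some x) None (Some x # t # p)" using path by blast
    then have h: "distinct (Some x # t # p)" "successively hasse_adj (Some x # t # p)"
        "last (Some x # t # p) = None"
      by (auto simp: hasse_path_def)
    have "\<not> covered_by (Some x) t"
    proof
      assume "covered_by (Some x) t"
      have "Some x < last (Some x # t # p)"
      proof (rule ascending_path)
        show "a = b" if "covered_by a c" "covered_by b c" for a b c :: "'a option"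
          using that by (rule unique)
      qed fact+
      then show False using h(3) by simp
    qed
    then have "covered_by t (Some x)" using h(2) by (simp add: hasse_adj_def)
    then show ?thesis using y unique by blast
  qed
  then have "parent x = y"
    unfolding parent_def by - (rule the_equality, rule ex, blast)
  then show ?thesis using y by simp
qed

lemma parent_less:
  fixes x :: "'a::order"
  assumes "locally_finite_poset ((\<le>) :: 'a \<Rightarrow> 'a \<Rightarrow> bool)" "rooted_forest TYPE('a)"
  shows "parent x < Some x"
  using covered_by_parent[OF assms] by (simp add: covered_by_def)

text \<open>Everything strictly below \<open>Some x\<close> lies below one of its lower covers, and
  \<open>parent x\<close> is the only one.\<close>

lemma Some_le_parent_iff:
  fixes a x :: "'a::order"
  assumes lf: "locally_finite_poset ((\<le>) :: 'a \<Rightarrow> 'a \<Rightarrow> bool)" and rf: "rooted_forest TYPE('a)"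
  shows "Some a \<le> parent x \<longleftrightarrow> a < x"
proof
  assume "Some a \<le> parent x"
  then show "a < x"
    using parent_less[OF assms, of x] by (metis less_option_Some order_le_less_trans)
next
  assume "a < x"
  then obtain z where "covered_by z (Some x)" "Some a \<le> z"
    using ex_lower_cover_above[OF finite_atMost_option[OF finite_down_set[OF lf rf]],
        of "Some a" "Some x"] by auto
  then show "Some a \<le> parent x"
    using unique_lower_cover_option[OF lf rf] covered_by_parent[OF assms] by blast
qed

lemma parent_eq_None_iff:
  fixes x :: "'a::order"
  assumes "locally_finite_poset ((\<le>) :: 'a \<Rightarrow> 'a \<Rightarrow> bool)" "rooted_forest TYPE('a)"
  shows "parent x = None \<longleftrightarrow> \<not> (\<exists>y. y < x)"
proof (cases "parent x")
  case None
  then show ?thesis using Some_le_parent_iff[OF assms, of _ x] by simp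
next
  case (Some y)
  then show ?thesis using Some_le_parent_iff[OF assms, of y x] by auto
qed

section \<open>Subword order as list embedding\<close>

text \<open>Greedy matching needs rules that compare first letters; \<open>list_emb\<close> has
  them, the definition by index maps does not.\<close>

lemma gen_subword_eq_list_emb: "gen_subword = list_emb (\<le>)"
proof (intro ext iffI)
  fix u w :: "'a list"
  assume "gen_subword u w"
  then show "list_emb (\<le>) u w"
  proof (induction w arbitrary: u)
    case Nil
    then show ?case by (auto dest: gen_subword_length)
  next
    case (Cons b w)
    obtain i where i: "strict_mono_on {..<length u} i"
        "\<And>j. j < length u \<Longrightarrow> i j < length (b # w) \<and> u ! j \<le> (b # w) ! i j"
      using Cons.prems unfolding gen_subword_def by blast
    show ?case
    proof (cases u)
      case (Cons a v)
      \<comment> \<open>Positive positions keep the truncated subtraction of 1 below strictly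
        monotone.\<close>
      have pos: "0 < i (Suc j)" if "Suc j < length u" for j
        using strict_mono_onD[OF i(1), of j "Suc j"] that by simp
      have "gen_subword v w"
        unfolding gen_subword_def
      proof (intro exI[of _ "\<lambda>j. i (Suc j) - 1"] conjI allI impI)
        show "strict_mono_on {..<length v} (\<lambda>j. i (Suc j) - 1)"
        proof (rule strict_mono_onI)
          fix r s assume "r \<in> {..<length v}" "s \<in> {..<length v}" "r < s"
          then have "i (Suc r) < i (Suc s)" "0 < i (Suc r)"
            using strict_mono_onD[OF i(1), of "Suc r" "Suc s"] pos[of r] Cons by auto
          then show "i (Suc r) - 1 < i (Suc s) - 1" by simp
        qed
        fix j assume "j < length v"
        then show "i (Suc j) - 1 < length w" "v ! j \<le> w ! (i (Suc j) - 1)"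
          using i(2)[of "Suc j"] pos[of j] Cons by (auto simp: nth_Cons')
      qed
      then have emb: "list_emb (\<le>) v w" by (rule Cons.IH)
      show ?thesis
      proof (cases "i 0 = 0")
        case True
        then have "a \<le> b" using i(2)[of 0] Cons by simp
        then show ?thesis using emb Cons by auto
      next
        case False
        have pos': "0 < i j" if "j < length u" for j
          using pos False that by (cases j) auto
        have "gen_subword u w"
          unfolding gen_subword_def
        proof (intro exI[of _ "\<lambda>j. i j - 1"] conjI allI impI)
          show "strict_mono_on {..<length u} (\<lambda>j. i j - 1)"
          proof (rule strict_mono_onI)
            fix r s assume "r \<in> {..<length u}" "s \<in> {..<length u}" "r < s"
            then have "i r < i s" "0 < i r"
              using strict_mono_onD[OF i(1), of r s] pos'[of r] by auto
            then show "i r - 1 < i s - 1" by simp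
          qed
          fix j assume "j < length u"
          then show "i j - 1 < length w" "u ! j \<le> w ! (i j - 1)"
            using i(2)[of j] pos'[of j] by (auto simp: nth_Cons')
        qed
        then show ?thesis using Cons.IH by auto
      qed
    qed simp
  qed
next
  fix u w :: "'a list"
  assume "list_emb (\<le>) u w"
  then show "gen_subword u w"
  proof induction
    case (list_emb_Nil w)
    show ?case by (simp add: gen_subword_def)
  next
    case (list_emb_Cons u w b)
    then obtain i where i: "strict_mono_on {..<length u} i"
        "\<forall>j<length u. i j < length w \<and> u ! j \<le> w ! i j"
      unfolding gen_subword_def by blast
    then show ?case
      unfolding gen_subword_def
      by (intro exI[of _ "\<lambda>j. Suc (i j)"]) (auto simp: strict_mono_on_def)
  next
    case (list_emb_Cons2 a b u w)
    then obtain i where i: "strict_mono_on {..<length u} i"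
        "\<forall>j<length u. i j < length w \<and> u ! j \<le> w ! i j"
      unfolding gen_subword_def by blast
    then show ?case
      unfolding gen_subword_def using list_emb_Cons2.hyps
      \<comment> \<open>The first letter goes to position 0, all others are shifted past it.\<close>
      by (intro exI[of _ "case_nat 0 (\<lambda>j. Suc (i j))"])
        (auto simp: strict_mono_on_def nth_Cons split: nat.split)
  qed
qed

section \<open>Normal embeddings letter by letter\<close>

text \<open>An expansion determines the word it expands. Having that word as a function of the
  expansion allows the embeddings to be grouped by it.\<close>

definition letters :: "'a option list \<Rightarrow> 'a list" where
  "letters \<eta> = map the (filter (\<lambda>y. y \<noteq> None) \<eta>)"

lemma letters_Nil [simp]: "letters [] = []"
  and letters_Cons_None [simp]: "letters (None # \<eta>) = letters \<eta>"
  and letters_Cons_Some [simp]: "letters (Some a # \<eta>) = a # letters \<eta>"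
  by (simp_all add: letters_def)

lemma expansion_iff_letters: "expansion u \<eta> \<longleftrightarrow> letters \<eta> = u"
proof -
  have "nths \<eta> (Supp \<eta>) = filter (\<lambda>y. y \<noteq> None) \<eta>"
    by (simp add: filter_eq_nths Supp_def)
  also have "\<dots> = map Some (letters \<eta>)"
    by (induction \<eta>) (auto simp: letters_def)
  finally show ?thesis by (simp add: expansion_def inj_map_eq_map)
qed

text \<open>
  The argument \<open>c\<close> is the letter of \<open>w\<close> before the current position; it is \<open>None\<close> at the start.
  A position starts a run iff \<open>c\<close> differs from its letter.
\<close>

definition choices :: "'a::order option \<Rightarrow> 'a \<Rightarrow> 'a option set" where
  "choices c x = (if c \<noteq> Some x then {Some x, parent x}
    else if parent x = None then {Some x} else {Some x, parent x, None})"

fun normal_choices :: "'a::order option \<Rightarrow> 'a list \<Rightarrow> 'a option list set" where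
  "normal_choices c [] = {[]}"
| "normal_choices c (x # w) =
    (\<lambda>(y, \<eta>). y # \<eta>) ` (choices c x \<times> normal_choices (Some x) w)"

lemma finite_choices [simp]: "finite (choices c x)"
  by (simp add: choices_def)

lemma finite_normal_choices [simp]: "finite (normal_choices c w)"
  by (induction c w rule: normal_choices.induct) auto

text \<open>The list \<open>c # map Some w\<close> is \<open>w\<close> shifted by one place: its
  entry at \<open>i\<close> is the letter before position \<open>i\<close>.\<close>

lemma mem_normal_choices_iff:
  "\<eta> \<in> normal_choices c w \<longleftrightarrow>
    length \<eta> = length w \<and> (\<forall>i<length w. \<eta> ! i \<in> choices ((c # map Some w) ! i) (w ! i))"
proof (induction c w arbitrary: \<eta> rule: normal_choices.induct)
  case (2 c x w)
  show ?case
    by (cases \<eta>) (auto simp: 2 All_less_Suc2 image_iff)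
qed auto

section \<open>Runs and the normality condition\<close>

lemma ex_run_containing:
  assumes "i < length w"
  obtains r t where "run w (w ! i) r t" "r \<le> i" "i \<le> t"
proof -
  obtain x where x: "w ! i = x" by simp
  \<comment> \<open>The run around \<open>i\<close> is stretched as far as possible to the left by
    the least \<open>r\<close> and to the right by the greatest \<open>t\<close>; this extremality
    is what makes it maximal.\<close>
  define P where "P r \<longleftrightarrow> (\<forall>j\<in>{r..i}. w ! j = x)" for r
  define Q where "Q t \<longleftrightarrow> t < length w \<and> (\<forall>j\<in>{i..t}. w ! j = x)" for t
  define r where "r = Least P"
  define t where "t = Greatest Q"
  have "P i" "Q i" using assms x by (auto simp: P_def Q_def)
  have bound: "\<forall>t. Q t \<longrightarrow> t \<le> length w" by (simp add: Q_def)
  have r: "P r" "r \<le> i" unfolding r_def using \<open>P i\<close> by (auto intro: LeastI Least_le)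
  have t: "Q t" "i \<le> t" unfolding t_def
    using GreatestI_nat[of Q, OF \<open>Q i\<close>] Greatest_le_nat[of Q, OF \<open>Q i\<close>] bound by auto
  have "run w x r t"
    unfolding run_def
  proof (intro conjI allI impI)
    show "const_interval w x r t"
      unfolding const_interval_def
    proof (intro conjI ballI)
      show "r \<le> t" using r t by simp
      show "t < length w" using t by (simp add: Q_def)
      fix j assume "j \<in> {r..t}"
      then show "w ! j = x" using r t by (cases "j \<le> i") (auto simp: P_def Q_def)
    qed
    fix r' t' assume *: "const_interval w x r' t' \<and> {r..t} \<subseteq> {r'..t'}"
    moreover have "r \<le> t" using r t by simp
    ultimately have le: "r' \<le> r" "t \<le> t'" by simp_all
    have "P r'" "Q t'" using * le r(2) t(2) by (simp_all add: P_def Q_def const_interval_def)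
    then have "r \<le> r'" "t' \<le> t"
      unfolding r_def t_def using bound Greatest_le_nat[of Q t' "length w"] by (simp_all add: Least_le)
    then show "r' = r" "t' = t" using le by auto
  qed
  then show ?thesis using that r t x by blast
qed

text \<open>An equal letter just before \<open>r\<close> would extend the run, against its
  maximality. The leading \<open>None\<close> covers a run that starts the word.\<close>

lemma run_start_iff:
  assumes "run w x r t" "r \<le> i" "i \<le> t"
  shows "i = r \<longleftrightarrow> (None # map Some w) ! i \<noteq> Some x"
proof
  have c: "const_interval w x r t" using assms by (simp add: run_def)
  show "(None # map Some w) ! i \<noteq> Some x" if "i = r"
  proof
    assume prev: "(None # map Some w) ! i = Some x"
    then obtain j where j: "i = Suc j" by (cases i) auto
    have "j < length w" using c assms(3) j by (simp add: const_interval_def)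
    then have "w ! j = x" using prev j by simp
    then have "const_interval w x j t"
      using c j that by (auto simp: const_interval_def le_Suc_eq Suc_le_eq order_le_less)
    moreover have "{r..t} \<subseteq> {j..t}" using that j by auto
    ultimately have "j = r" using assms(1) unfolding run_def by blast
    then show False using that j by simp
  qed
  show "i = r" if "(None # map Some w) ! i \<noteq> Some x"
  proof (rule ccontr)
    assume "i \<noteq> r"
    then obtain j where "i = Suc j" "r \<le> j" using assms(2) by (cases i) auto
    then show False using that c assms(3) by (simp add: const_interval_def)
  qed
qed

text \<open>A minimal letter is forced into the support where it continues a run, any other letter
  where it starts one. Equality of the two truth values, minimal and continuing, captures both cases
  at a single position.\<close>

lemma run_condition_iff:
  fixes w :: "'a::order list"
  assumes len: "length \<eta> = length w"
  shows "(\<forall>x r t. run w x r t \<longrightarrow>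
      (if \<not> (\<exists>y. y < x) then {r + 1..t} \<subseteq> Supp \<eta> else r \<in> Supp \<eta>)) \<longleftrightarrow>
    (\<forall>i<length w. (\<not> (\<exists>y. y < w ! i)) = ((None # map Some w) ! i = Some (w ! i)) \<longrightarrow>
      \<eta> ! i \<noteq> None)"
    (is "?L \<longleftrightarrow> ?R")
proof
  assume L: ?L
  show ?R
  proof (intro allI impI)
    fix i
    assume i: "i < length w"
      and eq: "(\<not> (\<exists>y. y < w ! i)) = ((None # map Some w) ! i = Some (w ! i))"
    obtain r t where rt: "run w (w ! i) r t" "r \<le> i" "i \<le> t"
      using ex_run_containing[OF i] .
    have "i \<in> Supp \<eta>"
    proof (cases "\<exists>y. y < w ! i")
      case True
      then have "i = r" using eq run_start_iff[OF rt] by simp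
      then show ?thesis using L rt(1) True by metis
    next
      case False
      then have "i \<noteq> r" using eq run_start_iff[OF rt] by simp
      then have "i \<in> {r + 1..t}" using rt by auto
      then show ?thesis using L rt(1) False by (meson subsetD)
    qed
    then show "\<eta> ! i \<noteq> None" by (simp add: Supp_def)
  qed
next
  assume R: ?R
  show ?L
  proof (intro allI impI)
    fix x r t assume run: "run w x r t"
    then have x: "w ! i = x" "i < length w" if "r \<le> i" "i \<le> t" for i
      using that by (auto simp: run_def const_interval_def)
    have "r \<le> t" using run by (simp add: run_def const_interval_def)
    have "i \<in> Supp \<eta>" if "r \<le> i" "i \<le> t" "(\<exists>y. y < x) = (i = r)" for i
      using R x[OF that(1,2)] that(3) run_start_iff[OF run that(1,2)] len by (auto simp: Supp_def)
    then show "if \<not> (\<exists>y. y < x) then {r + 1..t} \<subseteq> Supp \<eta> else r \<in> Supp \<eta>"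
      using \<open>r \<le> t\<close> by auto
  qed
qed

lemma normal_embedding_iff:
  fixes w :: "'a::order list"
  assumes "locally_finite_poset ((\<le>) :: 'a \<Rightarrow> 'a \<Rightarrow> bool)" "rooted_forest TYPE('a)"
  shows "normal_embedding u w \<eta> \<longleftrightarrow> \<eta> \<in> normal_choices None w \<and> letters \<eta> = u"
proof (cases "length \<eta> = length w")
  case True
  have parent_le: "parent x \<le> Some x" for x :: 'a
    using parent_less[OF assms] by (rule less_imp_le)
  \<comment> \<open>For minimal \<open>x\<close> the parent is \<open>None\<close>, so removing
    \<open>None\<close> from the admissible values also removes the parent.\<close>
  have "y \<in> choices c x \<longleftrightarrow> y \<le> Some x \<and> y \<in> {Some x, parent x, None} \<and>
      ((\<not> (\<exists>z. z < x)) = (c = Some x) \<longrightarrow> y \<noteq> None)" for y c and x :: 'a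
    unfolding choices_def parent_eq_None_iff[OF assms, symmetric] using parent_le[of x] by auto
  then show ?thesis
    unfolding normal_embedding_def embedding_def expansion_iff_letters
      run_condition_iff[OF True] mem_normal_choices_iff by (auto simp: True)
qed (auto simp: normal_embedding_def embedding_def mem_normal_choices_iff)

lemma letters_le:
  fixes w :: "'a::order list"
  assumes "locally_finite_poset ((\<le>) :: 'a \<Rightarrow> 'a \<Rightarrow> bool)" "rooted_forest TYPE('a)"
    and "\<eta> \<in> normal_choices c w"
  shows "list_emb (\<le>) (letters \<eta>) w"
  using assms(3)
proof (induction c w arbitrary: \<eta> rule: normal_choices.induct)
  case (2 c x w)
  then obtain y \<theta> where \<eta>: "\<eta> = y # \<theta>" "y \<in> choices c x" "list_emb (\<le>) (letters \<theta>) w"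
    by auto
  have "parent x \<le> Some x"
    using parent_less[OF assms(1,2)] by (rule less_imp_le)
  then have "y \<le> Some x"
    using \<eta>(2) by (auto simp: choices_def split: if_splits)
  then show ?case using \<eta> by (cases y) auto
qed auto

section \<open>The inverse of the zeta function\<close>

lemma defect_Nil [simp]: "defect [] \<eta> = 0"
  by (simp add: defect_def)

lemma defect_Cons [simp]: "defect (x # w) (y # \<eta>) = of_bool (y = parent x) + defect w \<eta>"
proof -
  have "{i. i < length (x # w) \<and> (y # \<eta>) ! i = parent ((x # w) ! i)} =
      (if y = parent x then {0} else {}) \<union> Suc ` {i. i < length w \<and> \<eta> ! i = parent (w ! i)}"
    (is "?L = ?R")
  proof (rule set_eqI)
    fix i
    show "i \<in> ?L \<longleftrightarrow> i \<in> ?R" by (cases i) auto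
  qed
  then show ?thesis
    unfolding defect_def by (simp add: card_image)
qed

text \<open>For \<open>c = None\<close> this is the zeta function applied to the signed sums over
  normal embeddings. Other values of \<open>c\<close> arise when the first letter of
  \<open>w\<close> is split off.\<close>

definition upper_sum :: "'a::order option \<Rightarrow> 'a list \<Rightarrow> 'a list \<Rightarrow> int" where
  "upper_sum c w u =
    (\<Sum>\<eta>\<in>normal_choices c w. of_bool (list_emb (\<le>) u (letters \<eta>)) * (- 1) ^ defect w \<eta>)"

text \<open>The part of \<open>u\<close> still to be matched after the entry \<open>y\<close> has
  been read; \<open>None\<close> matches nothing.\<close>

definition greedy_rest :: "'a::order list \<Rightarrow> 'a option \<Rightarrow> 'a list" where
  "greedy_rest u y = (case u of [] \<Rightarrow> [] | a # v \<Rightarrow> if Some a \<le> y then v else u)"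

text \<open>Matching at the first opportunity loses nothing: if \<open>a # v\<close> embeds into the
  later letters, so does \<open>v\<close>.\<close>

lemma list_emb_letters_Cons_iff:
  "list_emb (\<le>) u (letters (y # \<eta>)) \<longleftrightarrow> list_emb (\<le>) (greedy_rest u y) (letters \<eta>)"
proof (cases "u = [] \<or> y = None")
  case True
  then show ?thesis by (auto simp: greedy_rest_def split: list.split)
next
  case False
  then obtain a v b where "u = a # v" "y = Some b" by (auto simp: neq_Nil_conv)
  then show ?thesis by (cases "a \<le> b") (simp_all add: greedy_rest_def)
qed

lemma upper_sum_Cons:
  fixes x :: "'a::order"
  assumes "locally_finite_poset ((\<le>) :: 'a \<Rightarrow> 'a \<Rightarrow> bool)" "rooted_forest TYPE('a)"
  shows "upper_sum c (x # w) u =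
    upper_sum (Some x) w (greedy_rest u (Some x)) - upper_sum (Some x) w (greedy_rest u (parent x))
    + of_bool (c = Some x) * upper_sum (Some x) w u"
proof -
  have "upper_sum c (x # w) u = (\<Sum>(y, \<eta>)\<in>choices c x \<times> normal_choices (Some x) w.
      of_bool (list_emb (\<le>) u (letters (y # \<eta>))) * (- 1) ^ defect (x # w) (y # \<eta>))"
    unfolding upper_sum_def normal_choices.simps
    by (subst sum.reindex) (auto simp: inj_on_def case_prod_unfold o_def)
  also have "\<dots> = (\<Sum>y\<in>choices c x. (- 1) ^ of_bool (y = parent x) *
      upper_sum (Some x) w (greedy_rest u y))"
    unfolding upper_sum_def list_emb_letters_Cons_iff defect_Cons sum.cartesian_product[symmetric]
    by (simp add: sum_distrib_left power_add mult_ac del: sum_of_bool_mult_eq sum_mult_of_bool_eq)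
  also have "\<dots> = upper_sum (Some x) w (greedy_rest u (Some x))
      - upper_sum (Some x) w (greedy_rest u (parent x))
      + of_bool (c = Some x) * upper_sum (Some x) w u"
  \<comment> \<open>If \<open>c = Some x\<close> and \<open>parent x = None\<close>, the only choice
    is \<open>Some x\<close>; the last two terms then cancel because
    \<open>greedy_rest u None = u\<close>.\<close>
  proof -
    have "parent x \<noteq> Some x"
      using parent_less[OF assms, of x] by auto
    moreover have "greedy_rest u None = u" by (simp add: greedy_rest_def split: list.split)
    ultimately show ?thesis by (auto simp: choices_def)
  qed
  finally show ?thesis .
qed

text \<open>The recursion passes to a tail with a preceding letter, so the claim is generalized to
  arbitrary \<open>c\<close>: \<open>w\<close> may then begin with extra copies of that letter. For
  \<open>c = None\<close> the prefix is empty.\<close>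

lemma upper_sum_eq:
  fixes w :: "'a::order list"
  assumes "locally_finite_poset ((\<le>) :: 'a \<Rightarrow> 'a \<Rightarrow> bool)" "rooted_forest TYPE('a)"
  shows "upper_sum c w u = of_bool (\<exists>p. w = p @ u \<and> set p \<subseteq> set_option c)"
proof (induction w arbitrary: c u)
  case Nil
  show ?case by (cases u) (simp_all add: upper_sum_def)
next
  case (Cons x w)
  have skip: "(\<exists>p. x # w = p @ u \<and> set p \<subseteq> set_option c) \<longleftrightarrow>
      u = x # w \<or> c = Some x \<and> (\<exists>p. w = p @ u \<and> set p \<subseteq> {x})" for u
    by (auto simp: Cons_eq_append_conv)
  show ?case
  proof (cases u)
    case Nil
    then show ?thesis
      unfolding upper_sum_Cons[OF assms] Cons.IH skip by (auto simp: greedy_rest_def)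
  next
    case u: (Cons a v)
    show ?thesis
    proof (cases "a = x")
      case True
      have "\<not> Some x \<le> parent x" using Some_le_parent_iff[OF assms, of x x] by simp
      \<comment> \<open>The first two terms of the recursion count \<open>v\<close> and
        \<open>x # v\<close> after copies of \<open>x\<close>. Moving one copy between prefix and
        suffix shows that they differ exactly when \<open>w = v\<close>.\<close>
      moreover have "(\<exists>p. w = p @ x # v \<and> set p \<subseteq> {x}) \<longleftrightarrow>
          (\<exists>p. w = p @ v \<and> set p \<subseteq> {x}) \<and> w \<noteq> v"
        (is "?L \<longleftrightarrow> ?R")
      proof
        assume ?L
        then obtain p where p: "w = p @ x # v" "set p \<subseteq> {x}" by blast
        then show ?R by (auto intro!: exI[of _ "p @ [x]"])
      next
        assume ?R
        then obtain p where p: "w = p @ v" "set p \<subseteq> {x}" "p \<noteq> []" by auto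
        then obtain q y where q: "p = q @ [y]" by (cases p rule: rev_cases) auto
        then have "w = q @ x # v" "set q \<subseteq> {x}" using p by auto
        then show ?L by blast
      qed
      ultimately show ?thesis
        unfolding upper_sum_Cons[OF assms] Cons.IH skip u
        using True by (auto simp: greedy_rest_def)
    next
      case False
      \<comment> \<open>The entries \<open>Some x\<close> and \<open>parent x\<close> now match
        alike, so the first two terms of the recursion cancel.\<close>
      then have "Some a \<le> Some x \<longleftrightarrow> Some a \<le> parent x"
        using Some_le_parent_iff[OF assms, of a x] by (simp add: order_less_le)
      then have "greedy_rest u (Some x) = greedy_rest u (parent x)"
        by (simp add: greedy_rest_def u)
      then show ?thesis
        unfolding upper_sum_Cons[OF assms] Cons.IH skip using False u by auto
    qed
  qed
qed

section \<open>Uniqueness of the inverse of the zeta function\<close>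

context locally_finite_poset
begin

lemma sum_mobius_interval:
  assumes "le x y"
  shows "(\<Sum>z | le x z \<and> le z y. mobius x z) = of_bool (x = y)"
proof (cases "x = y")
  case True
  then have "{z. le x z \<and> le z y} = {x}"
    using antisympD[OF antisymp] reflpD[OF reflp] by auto
  then show ?thesis using True by (simp add: mobius.simps)
next
  case False
  have "{z. le x z \<and> le z y} = insert y {z. le x z \<and> le z y \<and> z \<noteq> y}"
    using assms reflpD[OF reflp] by auto
  moreover have "finite {z. le x z \<and> le z y \<and> z \<noteq> y}"
    by (rule finite_subset[OF _ finite_interval[of x y]]) auto
  ultimately have "(\<Sum>z | le x z \<and> le z y. mobius x z) =
      mobius x y + (\<Sum>z | le x z \<and> le z y \<and> z \<noteq> y. mobius x z)"
    by simp
  also have "mobius x y = - (\<Sum>z | le x z \<and> le z y \<and> z \<noteq> y. mobius x z)"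
    using False assms by (subst mobius.simps) simp
  finally show ?thesis using False by simp
qed

text \<open>\<open>mobius\<close> is a left inverse of the zeta function, and \<open>f\<close> is a
  right inverse in the column of \<open>y\<close>. Summing \<open>mobius x v * f z\<close> over all
  \<open>v\<close> below \<open>z\<close> in the interval, in both orders, identifies them.\<close>

lemma mobius_eqI:
  assumes "le x y"
    and inv: "\<And>v. le v y \<Longrightarrow> (\<Sum>z | le v z \<and> le z y. f z) = of_bool (v = y)"
  shows "mobius x y = f x"
proof -
  let ?I = "{v. le x v \<and> le v y}"
  have trans: "le a c" if "le a b" "le b c" for a b c
    using that transpD[OF transp] by blast
  have "mobius x y = (\<Sum>v\<in>?I. mobius x v * of_bool (v = y))"
  proof -
    have "y \<in> ?I" using assms(1) reflpD[OF reflp] by simp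
    then have "?I \<inter> {y} = {y}" by blast
    then show ?thesis
      using finite_interval[of x y] \<open>y \<in> ?I\<close>
      by (simp add: of_bool_def if_distrib sum.delta cong: if_cong)
  qed
  also have "\<dots> = (\<Sum>v\<in>?I. \<Sum>z\<in>{z \<in> ?I. le v z}. mobius x v * f z)"
  proof (rule sum.cong[OF refl])
    fix v assume v: "v \<in> ?I"
    then have "{z \<in> ?I. le v z} = {z. le v z \<and> le z y}" using trans by blast
    then show "mobius x v * of_bool (v = y) = (\<Sum>z\<in>{z \<in> ?I. le v z}. mobius x v * f z)"
      using inv[of v] v by (simp add: sum_distrib_left[symmetric])
  qed
  also have "\<dots> = (\<Sum>z\<in>?I. \<Sum>v\<in>{v \<in> ?I. le v z}. mobius x v * f z)"
    using finite_interval[of x y] by (rule sum.swap_restrict) (rule finite_interval)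
  also have "\<dots> = (\<Sum>z\<in>?I. of_bool (x = z) * f z)"
  proof (rule sum.cong[OF refl])
    fix z assume z: "z \<in> ?I"
    then have "{v \<in> ?I. le v z} = {v. le x v \<and> le v z}" using trans by blast
    then show "(\<Sum>v\<in>{v \<in> ?I. le v z}. mobius x v * f z) = of_bool (x = z) * f z"
      using sum_mobius_interval[of x z] z by (simp add: sum_distrib_right[symmetric])
  qed
  also have "\<dots> = f x"
    using assms(1) reflpD[OF reflp] finite_interval[of x y]
    by (simp add: of_bool_def if_distrib[of "\<lambda>t. t * _"] sum.delta' cong: if_cong)
  finally show ?thesis .
qed

end

theorem theorem5p1:
  fixes u w :: "'a::order list"
  assumes "locally_finite_poset ((\<le>) :: 'a \<Rightarrow> 'a \<Rightarrow> bool)"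
    and "rooted_forest TYPE('a)"
    and "gen_subword u w"
  shows "locally_finite_poset.mobius gen_subword u w =
    (\<Sum>\<eta> | normal_embedding u w \<eta>. (- 1) ^ defect w \<eta>)"
proof (rule locally_finite_poset.mobius_eqI)
  show lf: "locally_finite_poset (gen_subword :: 'a list \<Rightarrow> 'a list \<Rightarrow> bool)"
    using assms(1,2) by (rule locally_finite_gen_subword)
  show "gen_subword u w" by fact
  fix v :: "'a list"
  let ?N = "normal_choices None w"
  let ?I = "{z. gen_subword v z \<and> gen_subword z w}"
  let ?A = "{\<eta> \<in> ?N. gen_subword v (letters \<eta>)}"
  have "{\<eta>. normal_embedding z w \<eta>} = {\<eta> \<in> ?A. letters \<eta> = z}" if "z \<in> ?I" for z
    using that by (auto simp: normal_embedding_iff[OF assms(1,2)])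
  then have "(\<Sum>z\<in>?I. \<Sum>\<eta> | normal_embedding z w \<eta>. (- 1) ^ defect w \<eta>) =
      (\<Sum>z\<in>?I. \<Sum>\<eta> | \<eta> \<in> ?A \<and> letters \<eta> = z. (- 1) ^ defect w \<eta> :: int)"
    by (intro sum.cong) auto
  \<comment> \<open>By \<open>letters_le\<close> and the choice of \<open>?A\<close>, every member
    of \<open>?A\<close> has its word in \<open>?I\<close>, so grouping by words covers each term
    once.\<close>
  also have "\<dots> = (\<Sum>\<eta>\<in>?A. (- 1) ^ defect w \<eta>)"
    using letters_le[OF assms(1,2)] locally_finite_poset.finite_interval[OF lf]
    by (intro sum.group) (auto simp: gen_subword_eq_list_emb)
  also have "\<dots> = upper_sum None w v"
    unfolding upper_sum_def
    by (rule sum.mono_neutral_cong_left) (auto simp: gen_subword_eq_list_emb)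
  also have "\<dots> = of_bool (v = w)"
    unfolding upper_sum_eq[OF assms(1,2)] by auto
  finally show "(\<Sum>z\<in>?I. \<Sum>\<eta> | normal_embedding z w \<eta>. (- 1) ^ defect w \<eta> :: int) =
      of_bool (v = w)" .
qed

end
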